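(* The function $h(x)=\sum_{p\text{ prime}}\frac{1}{xp^2-p+1}$ is strictly decreasing and strictly convex on $\bigl(\tfrac14,+\infty\bigr)$, with derivatives $$h'(x)=-\sum_p\frac{p^2}{(xp^2-p+1)^2},\qquad h''(x)=2\sum_p\frac{p^4}{(xp^2-p+1)^3}.$$ Both series converge absolutely and uniformly on compact subsets of $\bigl(\tfrac14,+\infty\bigr)$.
   Context: All sums over $p$ range over all prime numbers $p=2,3,5,7,\ldots$. *)

theory Defs
  imports
    "HOL-Analysis.Analysis"
    "HOL-Computational_Algebra.Primes"
begin

text \<open>
  Only values at \<open>x > 1/4\<close> matter; there every denominator is positive.
\<close>

definition h :: "real \<Rightarrow> real" where
  "h x = (\<Sum>\<^sub>\<infinity>p\<in>{p::nat. prime p}. 1 / (x * (real p)\<^sup>2 - real p + 1))"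

definition strictly_convex_on :: "'a::real_vector set \<Rightarrow> ('a \<Rightarrow> real) \<Rightarrow> bool" where
  "strictly_convex_on S f \<longleftrightarrow> convex S \<and>
    (\<forall>x\<in>S. \<forall>y\<in>S. x \<noteq> y \<longrightarrow>
      (\<forall>u>0. \<forall>v>0. u + v = 1 \<longrightarrow> f (u *\<^sub>R x + v *\<^sub>R y) < u * f x + v * f y))"

end

theory Submission
  imports Defs
begin

text \<open>
  Write \<open>D\<^sub>p(x) = x p\<^sup>2 - p + 1\<close>. The number \<open>1/4\<close> enters through the identity
  \<open>D\<^sub>p(x) = (x - 1/4) p\<^sup>2 + (p/2 - 1)\<^sup>2\<close>: for \<open>x > 1/4\<close> every denominator is positive, and on a
  half-line \<open>[a, \<infinity>)\<close> with \<open>a > 1/4\<close> it is at least \<open>(a - 1/4) p\<^sup>2\<close>, uniformly in \<open>x\<close>.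

  The three series in question are the cases \<open>k = 0, 1, 2\<close> of one family, with terms
  \<open>p\<^bsup>2k\<^esup> / D\<^sub>p(x)\<^bsup>k+1\<^esup>\<close>. This family is closed under differentiation in \<open>x\<close>, up to
  the factor \<open>-(k+1)\<close> (lemma \<open>prime_term_deriv\<close>), and by the lower bound on the denominator each
  term is at most a constant multiple of \<open>1/p\<^sup>2\<close> on \<open>[a, \<infinity>)\<close> (lemma \<open>prime_term_bound\<close>). The
  Weierstrass test therefore gives absolute and uniform convergence for every \<open>k\<close>, and
  termwise differentiation is justified (lemma \<open>prime_series_deriv\<close>).

  Strict monotonicity and strict convexity hold for each summand, since \<open>D\<^sub>p(x)\<close> is an increasing
  affine function of \<open>x\<close> and \<open>t \<mapsto> 1/t\<close> is strictly decreasing and strictly convex on the positive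
  reals. A sum of strict inequalities between convergent series is strict.
\<close>

section \<open>The family of series and its majorant\<close>

definition prime_term :: "nat \<Rightarrow> nat \<Rightarrow> real \<Rightarrow> real" where
  "prime_term k p x = real p ^ (2 * k) / (x * (real p)\<^sup>2 - real p + 1) ^ Suc k"

definition prime_series :: "nat \<Rightarrow> real \<Rightarrow> real" where
  "prime_series k x = (\<Sum>\<^sub>\<infinity>p\<in>{p::nat. prime p}. prime_term k p x)"

lemma h_eq_prime_series: "h = prime_series 0"
  by (simp add: fun_eq_iff h_def prime_series_def prime_term_def)

text \<open>Completing the square: the difference of the two sides is \<open>(p/2 - 1)\<^sup>2 + (x - a) p\<^sup>2\<close>.\<close>

lemma denominator_lower_bound:
  fixes a x :: real and p :: nat
  assumes "a \<le> x"
  shows "(a - 1/4) * (real p)\<^sup>2 \<le> x * (real p)\<^sup>2 - real p + 1"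
proof -
  have "0 \<le> (real p / 2 - 1)\<^sup>2" by simp
  moreover have "a * (real p)\<^sup>2 \<le> x * (real p)\<^sup>2" using assms by (intro mult_right_mono) auto
  ultimately show ?thesis by (simp add: power2_eq_square algebra_simps)
qed

lemma denominator_pos:
  fixes x :: real and p :: nat
  assumes "x > 1/4" "prime p"
  shows "0 < x * (real p)\<^sup>2 - real p + 1"
proof -
  have "0 < (x - 1/4) * (real p)\<^sup>2"
    using assms by (intro mult_pos_pos) (auto simp: prime_gt_0_nat)
  with denominator_lower_bound[of x x p] show ?thesis by simp
qed

lemma prime_term_nonneg:
  assumes "x > 1/4" "prime p"
  shows "0 \<le> prime_term k p x"
  using denominator_pos[OF assms] by (simp add: prime_term_def)

text \<open>
  Numerator \<open>p\<^bsup>2k\<^esup>\<close> and denominator of order \<open>p\<^bsup>2k+2\<^esup>\<close> leave the same decay \<open>1/p\<^sup>2\<close>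
  for every \<open>k\<close>.
\<close>

lemma prime_term_bound:
  assumes "a > 1/4" "a \<le> x" "prime p"
  shows "norm (prime_term k p x) \<le> (1 / (a - 1/4) ^ Suc k) * (1 / (real p)\<^sup>2)"
proof -
  have p: "real p > 0" using assms by (simp add: prime_gt_0_nat)
  have "prime_term k p x \<le> real p ^ (2 * k) / ((a - 1/4) * (real p)\<^sup>2) ^ Suc k"
    unfolding prime_term_def
    using assms p
    by (intro divide_left_mono power_mono denominator_lower_bound mult_pos_pos zero_less_power
          denominator_pos) auto
  also have "\<dots> = (1 / (a - 1/4) ^ Suc k) * (1 / (real p)\<^sup>2)"
    unfolding power_mult power_mult_distrib using p by simp
  finally show ?thesis using prime_term_nonneg[of x p k] assms by simp
qed

lemma prime_term_deriv:
  assumes "x > 1/4" "prime p"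
  shows "(prime_term k p has_field_derivative - real (Suc k) * prime_term (Suc k) p x)
           (at x within S)"
proof -
  have D: "x * (real p)\<^sup>2 - real p + 1 \<noteq> 0" using denominator_pos[OF assms] by simp
  have alg: "- (c * (m * d ^ k * q)) / (d ^ Suc k * d ^ Suc k) = - m * (q * c / d ^ Suc (Suc k))"
    if "d \<noteq> 0" for c m d q :: real
    using that by (simp add: field_simps)
  have "((\<lambda>x. real p ^ (2 * k) / (x * (real p)\<^sup>2 - real p + 1) ^ Suc k) has_field_derivative
          - (real p ^ (2 * k) * (real (Suc k) * (x * (real p)\<^sup>2 - real p + 1) ^ k * (real p)\<^sup>2))
          / ((x * (real p)\<^sup>2 - real p + 1) ^ Suc k * (x * (real p)\<^sup>2 - real p + 1) ^ Suc k))
        (at x within S)"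
    using D by (auto intro!: derivative_eq_intros simp del: power_Suc of_nat_Suc)
  then show ?thesis
    unfolding alg[OF D] prime_term_def[abs_def] by (simp add: power2_eq_square mult_ac)
qed

section \<open>Absolute and uniform convergence\<close>

text \<open>
  The series over the primes as a series over all naturals, so that the results on
  sequential sums of functions become applicable.
\<close>

definition padded_term :: "nat \<Rightarrow> nat \<Rightarrow> real \<Rightarrow> real" where
  "padded_term k n x = (if prime n then prime_term k n x else 0)"

lemma padded_term_bound:
  assumes "a > 1/4" "a \<le> x"
  shows "norm (padded_term k n x) \<le> (1 / (a - 1/4) ^ Suc k) * (1 / (real n)\<^sup>2)"
proof (cases "prime n")
  case True
  with prime_term_bound[OF assms True, of k] show ?thesis by (simp only: padded_term_def if_True)
next
  case False
  with assms show ?thesis by (simp add: padded_term_def)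
qed

lemma summable_padded_bound: "summable (\<lambda>n. c * (1 / (real n)\<^sup>2))"
  by (intro summable_mult) (use inverse_power_summable[of 2, where 'a = real] in
      \<open>simp add: field_simps\<close>)

lemma summable_norm_padded_term:
  assumes "x > 1/4"
  shows "summable (\<lambda>n. norm (padded_term k n x))"
  by (rule summable_comparison_test'[OF summable_padded_bound[of "1 / (x - 1/4) ^ Suc k"], of 0])
     (use padded_term_bound[of x x k] assms in simp)

lemma prime_term_summable_on:
  assumes "x > 1/4"
  shows "(\<lambda>p. prime_term k p x) summable_on {p. prime p}"
proof -
  have "(\<lambda>n. padded_term k n x) summable_on UNIV"
    by (rule norm_summable_imp_summable_on[OF summable_norm_padded_term[OF assms]])
  then show ?thesis
    by (subst summable_on_cong_neutral[where g = "\<lambda>n. padded_term k n x" and T = UNIV])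
       (auto simp: padded_term_def)
qed

lemma abs_prime_term_summable_on:
  assumes "x > 1/4"
  shows "(\<lambda>p. \<bar>prime_term k p x\<bar>) summable_on {p. prime p}"
  using prime_term_summable_on[OF assms, of k] prime_term_nonneg[OF assms]
  by (subst summable_on_cong[where g = "\<lambda>p. prime_term k p x"]) auto

lemma prime_series_eq_suminf:
  assumes "x > 1/4"
  shows "prime_series k x = (\<Sum>n. padded_term k n x)"
proof -
  have "prime_series k x = (\<Sum>\<^sub>\<infinity>n. padded_term k n x)"
    unfolding prime_series_def by (rule infsum_cong_neutral) (auto simp: padded_term_def)
  also have "\<dots> = (\<Sum>n. padded_term k n x)"
    by (intro infsumI norm_summable_imp_has_sum summable_norm_padded_term
          summable_sums summable_norm_cancel[OF summable_norm_padded_term] assms)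
  finally show ?thesis .
qed

lemma prime_partial_sums_uniform_limit:
  assumes "compact K" "K \<subseteq> {1/4<..}"
  shows "uniform_limit K (\<lambda>N x. \<Sum>p | prime p \<and> p \<le> N. prime_term k p x)
           (prime_series k) sequentially"
proof (cases "K = {}")
  case False
  \<comment> \<open>The minimum of \<open>K\<close> still exceeds \<open>1/4\<close>, which makes the majorant uniform on \<open>K\<close>.\<close>
  obtain a where a: "a \<in> K" "\<And>x. x \<in> K \<Longrightarrow> a \<le> x"
    using compact_attains_inf[OF assms(1) False] by blast
  then have "a > 1/4" using assms by auto
  have "uniform_limit K (\<lambda>n x. \<Sum>i<n. padded_term k i x) (\<lambda>x. \<Sum>n. padded_term k n x) sequentially"
    by (rule Weierstrass_m_test[OF padded_term_bound[OF \<open>a > 1/4\<close> a(2)] summable_padded_bound])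
  then have "uniform_limit K (\<lambda>N x. \<Sum>i<Suc N. padded_term k i x)
               (\<lambda>x. \<Sum>n. padded_term k n x) sequentially"
    by (rule filterlim_compose[OF _ filterlim_Suc])
  also have "?this \<longleftrightarrow> ?thesis"
  proof (intro uniform_limit_cong always_eventually allI ballI)
    fix N x
    have eq: "{i \<in> {..<Suc N}. prime i} = {p. prime p \<and> p \<le> N}" by auto
    show "(\<Sum>i<Suc N. padded_term k i x) = (\<Sum>p | prime p \<and> p \<le> N. prime_term k p x)"
      unfolding padded_term_def eq[symmetric] by (rule sum.inter_filter[symmetric]) simp
  next
    fix x assume "x \<in> K"
    then show "(\<Sum>n. padded_term k n x) = prime_series k x"
      using assms prime_series_eq_suminf[of x k] by auto
  qed
  finally show ?thesis .
qed simp

section \<open>Termwise differentiation\<close>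

text \<open>
  Termwise differentiation on a half-line \<open>[a, \<infinity>)\<close> with \<open>1/4 < a < x\<close>: there the series of
  derivatives is a constant multiple of the next member of the family, so the same
  majorant applies to it.
\<close>

lemma prime_series_deriv:
  assumes "x > 1/4"
  shows "(prime_series k has_field_derivative - real (Suc k) * prime_series (Suc k) x) (at x)"
proof -
  define a where "a = (x + 1/4) / 2"
  have a: "a > 1/4" "a < x" using assms by (auto simp: a_def)
  let ?f' = "\<lambda>n y. - real (Suc k) * padded_term (Suc k) n y"
  have "((\<lambda>y. \<Sum>n. padded_term k n y) has_field_derivative (\<Sum>n. ?f' n x)) (at x)"
  proof (rule has_field_derivative_series'(2)[of "{a..}" _ _ x])
    fix n y assume "y \<in> {a..}"
    then have "y > 1/4" using a by simp
    then show "(padded_term k n has_field_derivative ?f' n y) (at y within {a..})"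
      using prime_term_deriv[of y n k "{a..}"]
      by (cases "prime n") (simp_all add: padded_term_def[abs_def] del: of_nat_Suc)
  next
    show "uniformly_convergent_on {a..} (\<lambda>n y. \<Sum>i<n. ?f' i y)"
    proof (rule Weierstrass_m_test')
      fix n y assume "y \<in> {a..}"
      then have "norm (padded_term (Suc k) n y) \<le> 1 / (a - 1/4) ^ Suc (Suc k) * (1 / (real n)\<^sup>2)"
        using a(1) by (intro padded_term_bound) auto
      then show "norm (?f' n y)
          \<le> real (Suc k) * (1 / (a - 1/4) ^ Suc (Suc k) * (1 / (real n)\<^sup>2))"
        unfolding norm_mult by (intro mult_mono) auto
    qed (intro summable_mult summable_padded_bound)
  next
    show "summable (\<lambda>n. padded_term k n x)"
      by (rule summable_norm_cancel[OF summable_norm_padded_term[OF assms]])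
  qed (use a in auto)
  also have "(\<Sum>n. ?f' n x) = - real (Suc k) * prime_series (Suc k) x"
    unfolding prime_series_eq_suminf[OF assms]
    by (intro suminf_mult summable_norm_cancel[OF summable_norm_padded_term[OF assms]])
  finally show ?thesis
    by (rule has_field_derivative_transform_within_open[where S = "{1/4<..}"])
       (use assms prime_series_eq_suminf in auto)
qed

section \<open>Strict monotonicity and strict convexity\<close>

lemma prime_series_has_sum:
  assumes "x > 1/4"
  shows "((\<lambda>p. prime_term k p x) has_sum prime_series k x) {p. prime p}"
  unfolding prime_series_def by (rule has_sum_infsum[OF prime_term_summable_on[OF assms]])

lemma h_strict_antimono: "strict_antimono_on {1/4<..} h"
proof (rule monotone_onI)
  fix x y :: real assume xy: "x \<in> {1/4<..}" "y \<in> {1/4<..}" "x < y"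
  have less: "prime_term 0 p y < prime_term 0 p x" if "prime p" for p
  proof -
    have "x * (real p)\<^sup>2 < y * (real p)\<^sup>2"
      using xy that by (intro mult_strict_right_mono) (auto simp: prime_gt_0_nat)
    then show ?thesis
      using denominator_pos[of x p] denominator_pos[of y p] xy that
      by (simp add: prime_term_def frac_less2)
  qed
  \<comment> \<open>Besides the termwise comparison one strict instance is needed; the prime \<open>2\<close> serves.\<close>
  show "h y < h x"
    unfolding h_eq_prime_series
    by (rule has_sum_strict_mono[OF prime_series_has_sum prime_series_has_sum, where x = 2])
       (use less xy in \<open>auto intro: less_imp_le\<close>)
qed

text \<open>
  After clearing denominators, the right-hand side exceeds the left-hand side by
  \<open>u v (s - t)\<^sup>2 > 0\<close>.
\<close>

lemma inverse_strictly_convex: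
  fixes s t u v :: real
  assumes "s > 0" "t > 0" "s \<noteq> t" "u > 0" "v > 0" "u + v = 1"
  shows "1 / (u * s + v * t) < u * (1 / s) + v * (1 / t)"
proof -
  have v: "v = 1 - u" using assms by simp
  have "0 < u * v * (s - t)\<^sup>2" using assms by simp
  also have "\<dots> = (u * t + v * s) * (u * s + v * t) - s * t"
    unfolding v by (simp add: power2_eq_square algebra_simps)
  finally have "s * t < (u * t + v * s) * (u * s + v * t)" by simp
  moreover have "u * s + v * t > 0" using assms by (intro add_pos_pos mult_pos_pos)
  moreover have "u * (1 / s) + v * (1 / t) = (u * t + v * s) / (s * t)"
    using assms by (simp add: field_simps)
  ultimately show ?thesis using assms by (simp add: divide_simps mult_ac)
qed

lemma h_strictly_convex: "strictly_convex_on {1/4<..} h"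
  unfolding strictly_convex_on_def
proof (intro conjI ballI impI allI)
  fix x y u v :: real
  assume xy: "x \<in> {1/4<..}" "y \<in> {1/4<..}" "x \<noteq> y" and uv: "u > 0" "v > 0" "u + v = 1"
  let ?z = "u *\<^sub>R x + v *\<^sub>R y"
  have z: "?z > 1/4"
    using convexD[of "{1/4<..}" x y u v] xy uv by simp
  have less: "prime_term 0 p ?z < u * prime_term 0 p x + v * prime_term 0 p y" if "prime p" for p
  proof -
    let ?D = "\<lambda>w. w * (real p)\<^sup>2 - real p + 1"
    have "?D ?z = u * ?D x + v * ?D y + (u + v - 1) * (real p - 1)"
      by (simp add: algebra_simps)
    then have "?D ?z = u * ?D x + v * ?D y" using uv by simp
    moreover have "?D x \<noteq> ?D y" using xy that by auto
    ultimately show ?thesis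
      using inverse_strictly_convex[of "?D x" "?D y" u v] uv
        denominator_pos[of x p] denominator_pos[of y p] xy that
      by (simp add: prime_term_def)
  qed
  have rhs: "((\<lambda>p. u * prime_term 0 p x + v * prime_term 0 p y) has_sum
               u * prime_series 0 x + v * prime_series 0 y) {p. prime p}"
    using xy by (intro has_sum_add has_sum_cmult_right prime_series_has_sum) auto
  show "h ?z < u * h x + v * h y"
    unfolding h_eq_prime_series
    by (rule has_sum_strict_mono[OF prime_series_has_sum[OF z] rhs, where x = 2])
       (use less in \<open>auto intro: less_imp_le\<close>)
qed simp

section \<open>The three series together\<close>

theorem proposition2p3:
  shows "(\<forall>x::real. x > 1/4 \<longrightarrow>
           (\<lambda>p. \<bar>1 / (x * (real p)\<^sup>2 - real p + 1)\<bar>) summable_on {p::nat. prime p}) \<and>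
         (strict_antimono_on {1/4<..} h) \<and>
         (strictly_convex_on {1/4<..} h) \<and>
         (\<forall>x>1/4. (h has_real_derivative
           - (\<Sum>\<^sub>\<infinity>p\<in>{p::nat. prime p}. (real p)\<^sup>2 / (x * (real p)\<^sup>2 - real p + 1)\<^sup>2)) (at x)) \<and>
         (\<forall>x>1/4. (deriv h has_real_derivative
           2 * (\<Sum>\<^sub>\<infinity>p\<in>{p::nat. prime p}. (real p)^4 / (x * (real p)\<^sup>2 - real p + 1)^3)) (at x)) \<and>
         (\<forall>K::real set. compact K \<and> K \<subseteq> {1/4<..} \<longrightarrow>
           (\<forall>x\<in>K. (\<lambda>p. \<bar>(real p)\<^sup>2 / (x * (real p)\<^sup>2 - real p + 1)\<^sup>2\<bar>) summable_on {p::nat. prime p}) \<and>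
           uniform_limit K
             (\<lambda>N x. \<Sum>p\<in>{p::nat. prime p \<and> p \<le> N}. (real p)\<^sup>2 / (x * (real p)\<^sup>2 - real p + 1)\<^sup>2)
             (\<lambda>x. \<Sum>\<^sub>\<infinity>p\<in>{p::nat. prime p}. (real p)\<^sup>2 / (x * (real p)\<^sup>2 - real p + 1)\<^sup>2)
             sequentially) \<and>
         (\<forall>K::real set. compact K \<and> K \<subseteq> {1/4<..} \<longrightarrow>
           (\<forall>x\<in>K. (\<lambda>p. \<bar>(real p)^4 / (x * (real p)\<^sup>2 - real p + 1)^3\<bar>) summable_on {p::nat. prime p}) \<and>
           uniform_limit K
             (\<lambda>N x. \<Sum>p\<in>{p::nat. prime p \<and> p \<le> N}. (real p)^4 / (x * (real p)\<^sup>2 - real p + 1)^3)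
             (\<lambda>x. \<Sum>\<^sub>\<infinity>p\<in>{p::nat. prime p}. (real p)^4 / (x * (real p)\<^sup>2 - real p + 1)^3)
             sequentially)"
proof -
  have term0: "prime_term 0 = (\<lambda>p x. 1 / (x * (real p)\<^sup>2 - real p + 1))"
    and term1: "prime_term 1 = (\<lambda>p x. (real p)\<^sup>2 / (x * (real p)\<^sup>2 - real p + 1)\<^sup>2)"
    and term2: "prime_term 2 = (\<lambda>p x. (real p)^4 / (x * (real p)\<^sup>2 - real p + 1)^3)"
    by (simp_all add: fun_eq_iff prime_term_def numeral_2_eq_2[symmetric] numeral_3_eq_3[symmetric]
          del: power_Suc)
  have deriv1: "(h has_real_derivative - prime_series 1 x) (at x)" if "x > 1/4" for x
    using prime_series_deriv[OF that, of 0] by (simp add: h_eq_prime_series)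
  have deriv2: "(deriv h has_real_derivative 2 * prime_series 2 x) (at x)" if "x > 1/4" for x
  proof -
    have "((\<lambda>y. - prime_series 1 y) has_real_derivative 2 * prime_series 2 x) (at x)"
      using DERIV_minus[OF prime_series_deriv[OF that, of 1]] by (simp add: numeral_2_eq_2)
    then show ?thesis
      by (rule has_field_derivative_transform_within_open[where S = "{1/4<..}"])
         (use that DERIV_imp_deriv[OF deriv1] in auto)
  qed
  have compact_le: "x > 1/4" if "x \<in> K" "K \<subseteq> {1/4<..}" for x :: real and K
    using that by auto
  show ?thesis
    using abs_prime_term_summable_on[where k = 0] abs_prime_term_summable_on[where k = 1]
      abs_prime_term_summable_on[where k = 2] h_strict_antimono h_strictly_convex deriv1 deriv2
      prime_partial_sums_uniform_limit[where k = 1] prime_partial_sums_uniform_limit[where k = 2]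
      compact_le
    unfolding prime_series_def[abs_def] term0 term1 term2 by blast
qed

end
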